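(* Let $p^*_W$ be the value of the linear program over a single measure $$p^*_W=\inf_{\mu}\ \int_{K\times U}\sum_{j=1}^m l_j(t,x)\,u_j\,\mathrm{d}\mu(t,x,u)$$ subject to $\mu\in\mathcal{M}^+(K\times U)$ and $$v(T,x_T)-v(0,x_0)=\int_{K\times U}\Big(\frac{\partial v}{\partial t}(t,x)+\frac{\partial v}{\partial x}(t,x)\cdot\sum_{j=1}^m f_j(t,x)\,u_j\Big)\mathrm{d}\mu(t,x,u)\quad\text{for all } v\in C^1(K),$$ and let $p^*$ be the value of the linear program over $m$ measures $$p^*=\inf_{(\mu_1,\dots,\mu_m)}\ \sum_{j=1}^m\int_K l_j\,\mathrm{d}\mu_j$$ subject to $\mu_j\in\mathcal{M}^+(K)$, $j=1,\dots,m$, and $$v(T,x_T)-v(0,x_0)=\sum_{j=1}^m\int_K\Big(\frac{\partial v}{\partial t}+\frac{\partial v}{\partial x}\cdot f_j\Big)\mathrm{d}\mu_j\quad\text{for all } v\in C^1(K).$$ Then there is no relaxation gap between these two linear programs, i.e. $p^*=p^*_W$.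
   Context: Standing setting: $T>0$, $x_0,x_T\in\mathbb{R}^n$ are given; $X\subset\mathbb{R}^n$ is a given compact set and $K:=[0,T]\times X$; for $j=1,\dots,m$ the functions $f_j:K\to\mathbb{R}^n$ and $l_j:K\to\mathbb{R}$ are continuous in all their variables and Lipschitz continuous with respect to the state variable $x$. $U:=\{e_1,\dots,e_m\}\subset\mathbb{R}^m$ is the finite set of standard unit vectors of $\mathbb{R}^m$, and $u=(u_1,\dots,u_m)$ denotes a point of $U$. $\mathcal{M}^+(S)$ is the cone of finite non-negative Borel measures on $S$. $C^1(K)$ denotes the continuously differentiable test functions $v(t,x)$, understood as functions in $C^1(\mathbb{R}\times\mathbb{R}^n)$ whose derivatives are evaluated on $K$. The infimum over an empty set is $+\infty$. *)

theory Defs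
  imports "HOL-Analysis.Analysis"
begin

definition finite_borel_measures :: "'a::topological_space set \<Rightarrow> 'a measure set" where
  "finite_borel_measures S = {M. finite_measure M \<and> sets M = sets (restrict_space borel S)}"

definition C1_fun :: "(real \<times> (real ^ 'n) \<Rightarrow> real) \<Rightarrow> bool" where
  "C1_fun v \<longleftrightarrow> (\<exists>v' :: real \<times> (real ^ 'n) \<Rightarrow> (real \<times> (real ^ 'n)) \<Rightarrow>\<^sub>L real.
     (\<forall>z. (v has_derivative blinfun_apply (v' z)) (at z)) \<and> continuous_on UNIV v')"

definition partial_t :: "(real \<times> (real ^ 'n) \<Rightarrow> real) \<Rightarrow> real \<times> (real ^ 'n) \<Rightarrow> real" where
  "partial_t v = (\<lambda>(t, x). deriv (\<lambda>s. v (s, x)) t)"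

definition partial_x :: "(real \<times> (real ^ 'n) \<Rightarrow> real) \<Rightarrow> real \<times> (real ^ 'n) \<Rightarrow> real ^ 'n" where
  "partial_x v = (\<lambda>(t, x). \<chi> i. deriv (\<lambda>h. v (t, x + h *\<^sub>R axis i 1)) 0)"

definition unit_controls :: "(real ^ 'm) set" where
  "unit_controls = range (\<lambda>j. axis j 1)"

text \<open>
  Feasible measures of the two linear programs. The data \<open>f j\<close> and \<open>l j\<close> are total
  functions, of which only the values on \<open>{0..T} \<times> X\<close> (the space of the measures) matter.
  A test function \<open>v\<close> is defined on all of \<open>\<real> \<times> \<real>\<^sup>n\<close>, so the points \<open>x0\<close> and \<open>xT\<close>
  need not lie in \<open>X\<close>.
\<close>

definition feasible_W ::
  "real \<Rightarrow> (real ^ 'n) set \<Rightarrow> real ^ 'n \<Rightarrow> real ^ 'n \<Rightarrow>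
   ('m::finite \<Rightarrow> real \<times> (real ^ 'n) \<Rightarrow> real ^ 'n) \<Rightarrow> ((real \<times> (real ^ 'n)) \<times> (real ^ 'm)) measure set" where
  "feasible_W T X x0 xT f =
    {\<mu> \<in> finite_borel_measures (({0..T} \<times> X) \<times> unit_controls).
      \<forall>v. C1_fun v \<longrightarrow>
        v (T, xT) - v (0, x0) =
        (\<integral>(z, u). partial_t v z + partial_x v z \<bullet> (\<Sum>j\<in>UNIV. (u $ j) *\<^sub>R f j z) \<partial>\<mu>)}"

definition value_W ::
  "real \<Rightarrow> (real ^ 'n) set \<Rightarrow> real ^ 'n \<Rightarrow> real ^ 'n \<Rightarrow>
   ('m::finite \<Rightarrow> real \<times> (real ^ 'n) \<Rightarrow> real ^ 'n) \<Rightarrow> ('m \<Rightarrow> real \<times> (real ^ 'n) \<Rightarrow> real) \<Rightarrow> ereal" where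
  "value_W T X x0 xT f l =
    (INF \<mu>\<in>feasible_W T X x0 xT f. ereal (\<integral>(z, u). (\<Sum>j\<in>UNIV. l j z * (u $ j)) \<partial>\<mu>))"

definition feasible_modes ::
  "real \<Rightarrow> (real ^ 'n) set \<Rightarrow> real ^ 'n \<Rightarrow> real ^ 'n \<Rightarrow>
   ('m::finite \<Rightarrow> real \<times> (real ^ 'n) \<Rightarrow> real ^ 'n) \<Rightarrow> ('m \<Rightarrow> (real \<times> (real ^ 'n)) measure) set" where
  "feasible_modes T X x0 xT f =
    {\<mu>. (\<forall>j. \<mu> j \<in> finite_borel_measures ({0..T} \<times> X)) \<and>
      (\<forall>v. C1_fun v \<longrightarrow>
        v (T, xT) - v (0, x0) =
        (\<Sum>j\<in>UNIV. \<integral>z. (partial_t v z + partial_x v z \<bullet> f j z) \<partial>(\<mu> j)))}"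

definition value_modes ::
  "real \<Rightarrow> (real ^ 'n) set \<Rightarrow> real ^ 'n \<Rightarrow> real ^ 'n \<Rightarrow>
   ('m::finite \<Rightarrow> real \<times> (real ^ 'n) \<Rightarrow> real ^ 'n) \<Rightarrow> ('m \<Rightarrow> real \<times> (real ^ 'n) \<Rightarrow> real) \<Rightarrow> ereal" where
  "value_modes T X x0 xT f l =
    (INF \<mu>\<in>feasible_modes T X x0 xT f. ereal (\<Sum>j\<in>UNIV. \<integral>z. l j z \<partial>(\<mu> j)))"

end

theory Submission
  imports Defs
begin

text \<open>
  The control set \<open>U\<close> is finite, so \<open>K \<times> U\<close> is a disjoint union of \<open>m\<close> copies of \<open>K\<close>.
  A finite measure \<open>\<mu>\<close> on it is therefore the same thing as a tuple of \<open>m\<close> finite measures on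
  \<open>K\<close>: in one direction take the slices \<open>\<mu>\<^sub>j(A) = \<mu>(A \<times> {e\<^sub>j})\<close>, in the other one glue the
  \<open>\<mu>\<^sub>j\<close> along the embeddings \<open>z \<mapsto> (z, e\<^sub>j)\<close>. Integrals decompose accordingly,
  \<open>\<integral> g d\<mu> = \<Sum>\<^sub>j \<integral> g(z, e\<^sub>j) d\<mu>\<^sub>j(z)\<close>.
  At \<open>u = e\<^sub>j\<close> the controlled dynamics \<open>\<Sum>\<^sub>i u\<^sub>i f\<^sub>i\<close> reduces to \<open>f\<^sub>j\<close> and the controlled cost
  reduces to \<open>l\<^sub>j\<close>. Hence slicing maps the feasible set of the single-measure program onto
  that of the \<open>m\<close>-measure program and preserves the cost, so the two infima range over the
  same set of numbers.

  The argument rests on three facts: the decomposition of integrals (\<open>integral_slices\<close>), the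
  surjectivity of slicing (\<open>ex_measure_with_slices\<close>), and the continuity of the partial derivatives of
  a test function. The last one matters because the integrands must be integrable for the
  decomposition to hold, since the Bochner integral of a non-integrable function is \<open>0\<close> by
  convention; on the compact set \<open>K \<times> U\<close> continuity provides this.
\<close>

section \<open>Measures on a product with a finite set\<close>

lemma sets_finite_borel_measures:
  "M \<in> finite_borel_measures S \<Longrightarrow> sets M = sets (restrict_space borel S)"
  by (simp add: finite_borel_measures_def)

lemma space_finite_borel_measures:
  assumes "M \<in> finite_borel_measures S"
  shows "space M = S"
proof -
  have "space M = space (restrict_space borel S)"
    using assms by (intro sets_eq_imp_space_eq sets_finite_borel_measures)
  then show ?thesis by (simp add: space_restrict_space)
qed

lemma integrable_continuous_on_compact:
  fixes g :: "'a::topological_space \<Rightarrow> real"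
  assumes M: "M \<in> finite_borel_measures S" and "compact S" and g: "continuous_on S g"
  shows "integrable M g"
proof -
  interpret finite_measure M using M by (simp add: finite_borel_measures_def)
  have "bounded (g ` S)"
    using g \<open>compact S\<close> by (intro compact_imp_bounded compact_continuous_image)
  then obtain B where B: "\<And>x. x \<in> S \<Longrightarrow> norm (g x) \<le> B"
    unfolding bounded_iff by blast
  have meas: "g \<in> borel_measurable M"
    unfolding measurable_cong_sets[OF sets_finite_borel_measures[OF M] refl]
    by (rule borel_measurable_continuous_on_restrict[OF g])
  have "AE x in M. norm (g x) \<le> B"
    by (rule AE_I2) (simp only: space_finite_borel_measures[OF M] B)
  then show ?thesis using meas by (rule integrable_const_bound)
qed

text \<open>
  The slice of \<open>M\<close> at \<open>u\<close> is \<open>A \<mapsto> M (A \<times> {u})\<close>. Writing it as the first marginal of \<open>M\<close> cut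
  off by an indicator makes the transformation rules for densities and image measures applicable.
\<close>

definition slice_measure ::
  "'a::topological_space set \<Rightarrow> ('a \<times> 'b::t1_space) measure \<Rightarrow> 'b \<Rightarrow> 'a measure" where
  "slice_measure K M u = distr (density M (indicator (snd -` {u}))) (restrict_space borel K) fst"

lemma sets_slice_measure [simp]: "sets (slice_measure K M u) = sets (restrict_space borel K)"
  by (simp add: slice_measure_def)

context
  fixes K :: "'a::topological_space set" and U :: "'b::t1_space set" and M :: "('a \<times> 'b) measure"
  assumes M: "M \<in> finite_borel_measures (K \<times> U)"
begin

lemma measurable_fst_product: "fst \<in> measurable M (restrict_space borel K)"
proof -
  have "fst \<in> measurable (restrict_space borel (K \<times> U)) (restrict_space borel K)"
    by (intro measurable_restrict_space3 borel_measurable_continuous_onI continuous_intros) auto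
  then show ?thesis by (simp only: measurable_cong_sets[OF sets_finite_borel_measures[OF M] refl])
qed

lemma slice_in_sets: "snd -` {u} \<inter> space M \<in> sets M"
proof -
  have "closed (snd -` {u} :: ('a \<times> 'b) set)"
    by (intro closed_vimage_snd closed_singleton)
  then have "snd -` {u} \<in> sets (borel :: ('a \<times> 'b) measure)" by (rule borel_closed)
  then show ?thesis
    unfolding space_finite_borel_measures[OF M] sets_finite_borel_measures[OF M] sets_restrict_space by blast
qed

lemma indicator_slice_measurable:
  "(indicator (snd -` {u}) :: _ \<Rightarrow> real) \<in> borel_measurable M"
  "(indicator (snd -` {u}) :: _ \<Rightarrow> ennreal) \<in> borel_measurable M"
  using slice_in_sets[of u] by (simp_all only: borel_measurable_indicator_iff)

lemma emeasure_slice_measure: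
  assumes A: "A \<in> sets (restrict_space borel K)"
  shows "emeasure (slice_measure K M u) A = emeasure M ((A \<times> {u}) \<inter> space M)"
proof -
  have A': "fst -` A \<inter> space M \<in> sets M"
    using measurable_fst_product A by (rule measurable_sets)
  have "emeasure (slice_measure K M u) A = (\<integral>\<^sup>+ p. indicator (snd -` {u}) p * indicator (fst -` A \<inter> space M) p \<partial>M)"
    using A A' measurable_fst_product indicator_slice_measurable
    by (simp add: slice_measure_def emeasure_distr emeasure_density)
  also have "\<dots> = (\<integral>\<^sup>+ p. indicator ((A \<times> {u}) \<inter> space M) p \<partial>M)"
    by (intro nn_integral_cong) (auto simp: indicator_def)
  also have "\<dots> = emeasure M ((A \<times> {u}) \<inter> space M)"
  proof (rule nn_integral_indicator)
    have "(A \<times> {u}) \<inter> space M = (fst -` A \<inter> space M) \<inter> (snd -` {u} \<inter> space M)" by auto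
    then show "(A \<times> {u}) \<inter> space M \<in> sets M" using A' slice_in_sets by (simp only: sets.Int)
  qed
  finally show ?thesis .
qed

lemma slice_measure_finite_borel: "slice_measure K M u \<in> finite_borel_measures K"
proof -
  interpret finite_measure M using M by (simp add: finite_borel_measures_def)
  have "emeasure (slice_measure K M u) K = emeasure M ((K \<times> {u}) \<inter> space M)"
    by (rule emeasure_slice_measure) (auto simp: sets_restrict_space)
  then have "finite_measure (slice_measure K M u)"
    by (intro finite_measureI) (simp add: slice_measure_def space_restrict_space)
  then show ?thesis by (simp add: finite_borel_measures_def)
qed

text \<open>
  Since \<open>U\<close> is finite, the indicators of the sets \<open>K \<times> {u}\<close> sum to \<open>1\<close> on \<open>K \<times> U\<close>; each
  piece of the integral lives where the second coordinate is constant and is pushed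
  forward along the first projection.
\<close>

lemma integral_slices:
  fixes g :: "'a \<times> 'b \<Rightarrow> real"
  assumes "finite U" and "compact K" and g: "continuous_on (K \<times> U) g"
  shows "(\<integral>p. g p \<partial>M) = (\<Sum>u\<in>U. \<integral>z. g (z, u) \<partial>(slice_measure K M u))"
proof -
  have int: "integrable M g"
    by (rule integrable_continuous_on_compact[OF M _ g])
      (intro compact_Times \<open>compact K\<close> finite_imp_compact[OF \<open>finite U\<close>])
  have "(\<integral>p. g p \<partial>M) = (\<integral>p. (\<Sum>u\<in>U. indicator (snd -` {u}) p * g p) \<partial>M)"
  proof (rule Bochner_Integration.integral_cong[OF refl])
    fix p assume "p \<in> space M"
    then have "snd p \<in> U" by (simp add: space_finite_borel_measures[OF M] mem_Times_iff)
    then have "(\<Sum>u\<in>U. indicator (snd -` {u}) p * g p) = (\<Sum>u\<in>U. if u = snd p then g p else 0)"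
      by (intro sum.cong) (auto simp: indicator_def)
    also have "\<dots> = g p" using \<open>finite U\<close> \<open>snd p \<in> U\<close> by simp
    finally show "g p = (\<Sum>u\<in>U. indicator (snd -` {u}) p * g p)" by (rule sym)
  qed
  also have "\<dots> = (\<Sum>u\<in>U. \<integral>p. indicator (snd -` {u}) p * g p \<partial>M)"
  proof (rule Bochner_Integration.integral_sum)
    fix u
    show "integrable M (\<lambda>p. indicator (snd -` {u}) p * g p)"
    proof (rule Bochner_Integration.integrable_bound[OF int])
      show "(\<lambda>p. indicator (snd -` {u}) p * g p) \<in> borel_measurable M"
        by (intro borel_measurable_times indicator_slice_measurable
            borel_measurable_integrable[OF int])
    qed (simp add: indicator_def)
  qed
  also have "\<dots> = (\<Sum>u\<in>U. \<integral>z. g (z, u) \<partial>(slice_measure K M u))"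
  proof (rule sum.cong[OF refl])
    fix u assume "u \<in> U"
    have "continuous_on K (\<lambda>z. g (z, u))"
      by (rule continuous_on_compose2[OF g]) (use \<open>u \<in> U\<close> in \<open>auto intro!: continuous_intros\<close>)
    then have meas: "(\<lambda>z. g (z, u)) \<in> borel_measurable (restrict_space borel K)"
      by (rule borel_measurable_continuous_on_restrict)
    have meas': "(\<lambda>p. g (fst p, u)) \<in> borel_measurable M"
      using measurable_comp[OF measurable_fst_product meas] by (simp add: comp_def)
    have "(\<integral>z. g (z, u) \<partial>(slice_measure K M u))
        = (\<integral>p. g (fst p, u) \<partial>(density M (\<lambda>p. ennreal (indicator (snd -` {u}) p))))"
      unfolding slice_measure_def ennreal_indicator
      using meas measurable_fst_product by (intro integral_distr) auto
    also have "\<dots> = (\<integral>p. indicator (snd -` {u}) p *\<^sub>R g (fst p, u) \<partial>M)"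
      using meas' indicator_slice_measurable(1) by (intro integral_density) auto
    also have "\<dots> = (\<integral>p. indicator (snd -` {u}) p * g p \<partial>M)"
      by (intro Bochner_Integration.integral_cong) (auto simp: indicator_def)
    finally show "(\<integral>p. indicator (snd -` {u}) p * g p \<partial>M)
        = (\<integral>z. g (z, u) \<partial>(slice_measure K M u))" by (rule sym)
  qed
  finally show ?thesis .
qed

end

lemma ex_sum_measure:
  fixes N :: "'i \<Rightarrow> 'a measure"
  assumes "finite I" and sets: "\<And>i. i \<in> I \<Longrightarrow> sets (N i) = sets \<Omega>"
  shows "\<exists>M. sets M = sets \<Omega> \<and> (\<forall>B\<in>sets \<Omega>. emeasure M B = (\<Sum>i\<in>I. emeasure (N i) B))"
proof -
  define M where "M = measure_of (space \<Omega>) (sets \<Omega>) (\<lambda>B. \<Sum>i\<in>I. emeasure (N i) B)"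
  have "countably_additive (sets \<Omega>) (\<lambda>B. \<Sum>i\<in>I. emeasure (N i) B)"
  proof (rule countably_additiveI)
    fix A :: "nat \<Rightarrow> 'a set"
    assume A: "range A \<subseteq> sets \<Omega>" "disjoint_family A"
    have "(\<Sum>n. \<Sum>i\<in>I. emeasure (N i) (A n)) = (\<Sum>i\<in>I. \<Sum>n. emeasure (N i) (A n))"
      by (rule suminf_sum) auto
    also have "\<dots> = (\<Sum>i\<in>I. emeasure (N i) (\<Union>n. A n))"
      by (intro sum.cong suminf_emeasure) (use A sets in auto)
    finally show "(\<Sum>n. \<Sum>i\<in>I. emeasure (N i) (A n)) = (\<Sum>i\<in>I. emeasure (N i) (\<Union>n. A n))" .
  qed
  then have "emeasure M B = (\<Sum>i\<in>I. emeasure (N i) B)" if "B \<in> sets \<Omega>" for B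
    unfolding M_def using that
    by (intro emeasure_measure_of_sigma) (auto simp: positive_def sets.sigma_algebra_axioms)
  moreover have "sets M = sets \<Omega>"
    unfolding M_def by (simp add: sets.sigma_sets_eq)
  ultimately show ?thesis by blast
qed

text \<open>
  The prescribed slices are transported to \<open>K \<times> {u}\<close> by \<open>z \<mapsto> (z, u)\<close> and added up. The
  slice at \<open>u\<close> of the sum recovers \<open>\<nu> u\<close>, because the summand carried by \<open>K \<times> {w}\<close> does
  not charge \<open>A \<times> {u}\<close> unless \<open>w = u\<close>.
\<close>

lemma ex_measure_with_slices:
  fixes K :: "'a::topological_space set" and U :: "'b::t1_space set"
  assumes "finite U" and \<nu>: "\<And>u. u \<in> U \<Longrightarrow> \<nu> u \<in> finite_borel_measures K"
  shows "\<exists>M \<in> finite_borel_measures (K \<times> U). \<forall>u\<in>U. slice_measure K M u = \<nu> u"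
proof -
  define \<Omega> :: "('a \<times> 'b) measure" where "\<Omega> = restrict_space borel (K \<times> U)"
  have space_\<Omega>: "space \<Omega> = K \<times> U" by (simp add: \<Omega>_def space_restrict_space)
  have sets_\<nu>: "sets (\<nu> u) = sets (restrict_space borel K)" if "u \<in> U" for u
    using \<nu>[OF that] by (rule sets_finite_borel_measures)
  have space_\<nu>: "space (\<nu> u) = K" if "u \<in> U" for u
    using \<nu>[OF that] by (rule space_finite_borel_measures)
  have embed: "(\<lambda>z. (z, u)) \<in> measurable (\<nu> u) \<Omega>" if "u \<in> U" for u
  proof -
    have "(\<lambda>z. (z, u)) \<in> measurable (restrict_space borel K) \<Omega>"
      unfolding \<Omega>_def
      using that
      by (intro measurable_restrict_space3 borel_measurable_continuous_onI continuous_intros) auto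
    then show ?thesis by (simp only: measurable_cong_sets[OF sets_\<nu>[OF that] refl])
  qed
  obtain M where sets: "sets M = sets \<Omega>"
    and em: "\<And>B. B \<in> sets \<Omega> \<Longrightarrow> emeasure M B = (\<Sum>u\<in>U. emeasure (distr (\<nu> u) \<Omega> (\<lambda>z. (z, u))) B)"
    using ex_sum_measure[OF \<open>finite U\<close>, of "\<lambda>u. distr (\<nu> u) \<Omega> (\<lambda>z. (z, u))" \<Omega>] by auto
  have em': "emeasure M B = (\<Sum>w\<in>U. emeasure (\<nu> w) {z\<in>K. (z, w) \<in> B})" if "B \<in> sets \<Omega>" for B
    unfolding em[OF that] using that embed space_\<nu>
    by (intro sum.cong refl) (auto simp: emeasure_distr intro!: arg_cong2[where f=emeasure])
  have space_M: "space M = K \<times> U" using sets_eq_imp_space_eq[OF sets] space_\<Omega> by simp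
  have "finite_measure M"
  proof (rule finite_measureI)
    have "emeasure M (space M) = (\<Sum>w\<in>U. emeasure (\<nu> w) (space (\<nu> w)))"
      using em'[OF sets.top[of \<Omega>]] by (simp add: space_M space_\<Omega> space_\<nu>)
    also have "\<dots> \<noteq> \<infinity>"
      using \<nu> \<open>finite U\<close> by (auto simp: finite_borel_measures_def finite_measure.emeasure_finite)
    finally show "emeasure M (space M) \<noteq> \<infinity>" .
  qed
  then have M: "M \<in> finite_borel_measures (K \<times> U)"
    using sets by (simp add: finite_borel_measures_def \<Omega>_def)
  have "slice_measure K M u = \<nu> u" if "u \<in> U" for u
  proof (rule measure_eqI)
    show "sets (slice_measure K M u) = sets (\<nu> u)" by (simp add: sets_\<nu>[OF that])
    fix A assume "A \<in> sets (slice_measure K M u)"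
    then have A: "A \<in> sets (restrict_space borel K)" by simp
    then have "A \<subseteq> K" using sets.sets_into_space[OF A] by (simp add: space_restrict_space)
    have slice: "(A \<times> {u}) \<inter> space M = A \<times> {u}"
      using \<open>A \<subseteq> K\<close> that space_M by auto
    obtain A' where A': "A' \<in> sets borel" "A = K \<inter> A'"
      using A by (auto simp: sets_restrict_space)
    have "fst -` A' \<inter> snd -` {u} \<in> sets (borel :: ('a \<times> 'b) measure)"
    proof (rule sets.Int)
      have "fst -` A' \<inter> space borel \<in> sets (borel :: ('a \<times> 'b) measure)"
        by (rule measurable_sets[OF borel_measurable_continuous_onI A'(1)]) (intro continuous_intros)
      then show "fst -` A' \<in> sets (borel :: ('a \<times> 'b) measure)" by simp
      show "snd -` {u} \<in> sets (borel :: ('a \<times> 'b) measure)"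
        by (intro borel_closed closed_vimage_snd closed_singleton)
    qed
    moreover have "A \<times> {u} = (K \<times> U) \<inter> (fst -` A' \<inter> snd -` {u})" using A' that by auto
    ultimately have "A \<times> {u} \<in> sets \<Omega>" unfolding \<Omega>_def sets_restrict_space by blast
    then have "emeasure M (A \<times> {u}) = (\<Sum>w\<in>U. emeasure (\<nu> w) {z\<in>K. (z, w) \<in> A \<times> {u}})"
      by (rule em')
    also have "\<dots> = (\<Sum>w\<in>U. if w = u then emeasure (\<nu> u) A else 0)"
      using \<open>A \<subseteq> K\<close> by (intro sum.cong refl) (auto intro!: arg_cong2[where f=emeasure])
    also have "\<dots> = emeasure (\<nu> u) A" using \<open>finite U\<close> that by simp
    finally show "emeasure (slice_measure K M u) A = emeasure (\<nu> u) A"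
      using emeasure_slice_measure[OF M A] slice by simp
  qed
  with M show ?thesis by blast
qed

section \<open>Partial derivatives of test functions\<close>

text \<open>
  The partial derivatives are the values of the total derivative at the coordinate directions,
  and evaluation at a fixed direction is continuous for the operator norm.
\<close>

lemma C1_fun_continuous_partials:
  fixes v :: "real \<times> (real ^ 'n) \<Rightarrow> real"
  assumes "C1_fun v"
  shows "continuous_on S (partial_t v)" and "continuous_on S (partial_x v)"
proof -
  obtain v' :: "real \<times> (real ^ 'n) \<Rightarrow> (real \<times> (real ^ 'n)) \<Rightarrow>\<^sub>L real"
    where v': "\<And>z. (v has_derivative blinfun_apply (v' z)) (at z)"
      and cont: "continuous_on UNIV v'"
    using assms by (auto simp: C1_fun_def)
  have t: "partial_t v z = v' z (1, 0)" for z
  proof -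
    obtain t x where z: "z = (t, x)" by (cases z)
    have "((\<lambda>s. v (s, x)) has_derivative (\<lambda>h. v' (t, x) (h, 0))) (at t)"
      by (rule has_derivative_compose[OF _ v']) (auto intro!: derivative_eq_intros)
    moreover have "(\<lambda>h. v' (t, x) (h, 0)) = (*) (v' (t, x) (1, 0))"
    proof
      fix h :: real
      have "(h, 0) = h *\<^sub>R (1, 0 :: real ^ 'n)" by simp
      then show "v' (t, x) (h, 0) = v' (t, x) (1, 0) * h"
        by (metis blinfun.scaleR_right mult.commute real_scaleR_def)
    qed
    ultimately have "((\<lambda>s. v (s, x)) has_field_derivative v' (t, x) (1, 0)) (at t)"
      by (simp add: has_field_derivative_def)
    then show ?thesis by (simp add: partial_t_def z DERIV_imp_deriv)
  qed
  have x: "partial_x v z = (\<chi> i. v' z (0, axis i 1))" for z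
  proof -
    obtain t x where z: "z = (t, x)" by (cases z)
    have "deriv (\<lambda>h. v (t, x + h *\<^sub>R axis i 1)) 0 = v' (t, x) (0, axis i 1)" for i
    proof -
      have "((\<lambda>h. v (t, x + h *\<^sub>R axis i 1)) has_derivative (\<lambda>h. v' (t, x) (0, h *\<^sub>R axis i 1))) (at 0)"
        by (rule has_derivative_compose[where g=v and g'="v' (t, x)" and f="\<lambda>h. (t, x + h *\<^sub>R axis i 1)"])
          (use v'[of "(t, x)"] in \<open>auto intro!: derivative_eq_intros\<close>)
      moreover have "(\<lambda>h. v' (t, x) (0, h *\<^sub>R axis i 1)) = (*) (v' (t, x) (0, axis i 1))"
      proof
        fix h :: real
        have "(0, h *\<^sub>R axis i 1) = h *\<^sub>R (0 :: real, axis i 1 :: real ^ 'n)" by simp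
        then show "v' (t, x) (0, h *\<^sub>R axis i 1) = v' (t, x) (0, axis i 1) * h"
          by (metis blinfun.scaleR_right mult.commute real_scaleR_def)
      qed
      ultimately show ?thesis
        by (intro DERIV_imp_deriv) (simp add: has_field_derivative_def)
    qed
    then show ?thesis by (simp add: partial_x_def z)
  qed
  have cont_S: "continuous_on S v'" using cont continuous_on_subset by blast
  show "continuous_on S (partial_t v)" "continuous_on S (partial_x v)"
    unfolding t[abs_def] x[abs_def] by (intro continuous_intros cont_S)+
qed

section \<open>Equality of the two values\<close>

lemma sum_unit_controls:
  fixes h :: "real ^ 'm::finite \<Rightarrow> 'b::comm_monoid_add"
  shows "(\<Sum>u\<in>unit_controls. h u) = (\<Sum>j\<in>UNIV. h (axis j (1::real)))"
proof -
  have "inj (\<lambda>j::'m. axis j (1::real))" by (auto simp: inj_def axis_eq_axis)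
  then show ?thesis unfolding unit_controls_def by (simp add: sum.reindex)
qed

lemma sum_axis:
  fixes a :: "'m::finite \<Rightarrow> 'b::real_vector"
  shows "(\<Sum>i\<in>UNIV. (axis j (1::real) $ i) *\<^sub>R a i) = a j"
proof -
  have "(\<Sum>i\<in>UNIV. (axis j (1::real) $ i) *\<^sub>R a i) = (\<Sum>i\<in>UNIV. if i = j then a i else 0)"
    by (intro sum.cong) (auto simp: axis_def)
  then show ?thesis by simp
qed

context
  fixes T :: real and x0 xT :: "real ^ 'n" and X :: "(real ^ 'n) set"
    and f :: "'m::finite \<Rightarrow> real \<times> (real ^ 'n) \<Rightarrow> real ^ 'n"
    and l :: "'m \<Rightarrow> real \<times> (real ^ 'n) \<Rightarrow> real"
  assumes X: "compact X"
    and f: "\<And>j. continuous_on ({0..T} \<times> X) (f j)"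
    and l: "\<And>j. continuous_on ({0..T} \<times> X) (l j)"
begin

abbreviation "modes_of M \<equiv> (\<lambda>j. slice_measure ({0..T} \<times> X) M (axis j (1::real)))"

lemma integral_unit_controls:
  fixes g :: "(real \<times> (real ^ 'n)) \<times> (real ^ 'm) \<Rightarrow> real"
  assumes "M \<in> finite_borel_measures (({0..T} \<times> X) \<times> unit_controls)"
    and "continuous_on (({0..T} \<times> X) \<times> unit_controls) g"
  shows "(\<integral>p. g p \<partial>M) = (\<Sum>j\<in>UNIV. \<integral>z. g (z, axis j 1) \<partial>(modes_of M j))"
  using integral_slices[OF assms(1) _ _ assms(2)] X
  by (simp add: sum_unit_controls compact_Times) (simp add: unit_controls_def)

lemma cost_modes_of:
  assumes "M \<in> finite_borel_measures (({0..T} \<times> X) \<times> unit_controls)"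
  shows "(\<integral>(z, u). (\<Sum>j\<in>UNIV. l j z * (u $ j)) \<partial>M) = (\<Sum>j\<in>UNIV. \<integral>z. l j z \<partial>(modes_of M j))"
proof -
  have "continuous_on (({0..T} \<times> X) \<times> unit_controls) (\<lambda>(z, u). \<Sum>j\<in>UNIV. l j z * (u $ j))"
    unfolding split_beta by (intro continuous_intros continuous_on_compose2[OF l]) auto
  note integral_unit_controls[OF assms this]
  moreover have "(\<Sum>i\<in>UNIV. l i z * (axis j 1 $ i)) = l j z" for j z
    using sum_axis[of j "\<lambda>i. l i z"] by (simp add: mult.commute)
  ultimately show ?thesis by simp
qed

lemma transport_modes_of:
  assumes "M \<in> finite_borel_measures (({0..T} \<times> X) \<times> unit_controls)" and v: "C1_fun v"
  shows "(\<integral>(z, u). partial_t v z + partial_x v z \<bullet> (\<Sum>j\<in>UNIV. (u $ j) *\<^sub>R f j z) \<partial>M)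
    = (\<Sum>j\<in>UNIV. \<integral>z. (partial_t v z + partial_x v z \<bullet> f j z) \<partial>(modes_of M j))"
proof -
  have "continuous_on (({0..T} \<times> X) \<times> unit_controls)
      (\<lambda>(z, u). partial_t v z + partial_x v z \<bullet> (\<Sum>j\<in>UNIV. (u $ j) *\<^sub>R f j z))"
    unfolding split_beta
    by (intro continuous_intros continuous_on_compose2[OF f]
        continuous_on_compose2[OF C1_fun_continuous_partials(1)[OF v, of UNIV]]
        continuous_on_compose2[OF C1_fun_continuous_partials(2)[OF v, of UNIV]]) auto
  from integral_unit_controls[OF assms(1) this] show ?thesis
    by (simp add: sum_axis)
qed

lemma feasible_modes_eq_image:
  "feasible_modes T X x0 xT f = modes_of ` feasible_W T X x0 xT f"
proof (intro equalityI subsetI)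
  fix \<mu> assume \<mu>: "\<mu> \<in> feasible_modes T X x0 xT f"
  \<comment> \<open>A mode \<open>j\<close> is read off from the control \<open>e\<^sub>j\<close> through the inverse of \<open>j \<mapsto> e\<^sub>j\<close>.\<close>
  define \<nu> where "\<nu> u = \<mu> (inv (\<lambda>j::'m. axis j (1::real)) u)" for u
  have "inj (\<lambda>j::'m. axis j (1::real))" by (auto simp: inj_def axis_eq_axis)
  from inv_f_f[OF this] have \<nu>_axis: "\<nu> (axis j 1) = \<mu> j" for j
    unfolding \<nu>_def by (rule arg_cong)
  have "\<nu> u \<in> finite_borel_measures ({0..T} \<times> X)" for u
    using \<mu> by (simp add: feasible_modes_def \<nu>_def)
  moreover have "finite (unit_controls :: (real ^ 'm) set)" by (simp add: unit_controls_def)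
  ultimately obtain M where M: "M \<in> finite_borel_measures (({0..T} \<times> X) \<times> unit_controls)"
    and "\<forall>u\<in>unit_controls. slice_measure ({0..T} \<times> X) M u = \<nu> u"
    using ex_measure_with_slices[of unit_controls \<nu>] by blast
  then have eq: "modes_of M = \<mu>" by (auto simp: unit_controls_def \<nu>_axis)
  have "M \<in> feasible_W T X x0 xT f"
    using \<mu> by (simp add: feasible_W_def M transport_modes_of[OF M] feasible_modes_def flip: eq)
  with eq show "\<mu> \<in> modes_of ` feasible_W T X x0 xT f" by blast
next
  fix \<mu> assume "\<mu> \<in> modes_of ` feasible_W T X x0 xT f"
  then obtain M where M: "M \<in> feasible_W T X x0 xT f" "\<mu> = modes_of M" by blast
  then have "M \<in> finite_borel_measures (({0..T} \<times> X) \<times> unit_controls)"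
    by (simp add: feasible_W_def)
  with M show "\<mu> \<in> feasible_modes T X x0 xT f"
    by (simp add: feasible_W_def feasible_modes_def slice_measure_finite_borel transport_modes_of)
qed

lemma value_modes_eq_value_W: "value_modes T X x0 xT f l = value_W T X x0 xT f l"
  unfolding value_modes_def value_W_def feasible_modes_eq_image image_image
  by (intro INF_cong refl) (simp add: feasible_W_def cost_modes_of)

end

theorem theorem2:
  fixes T :: real
    and x0 xT :: "real ^ 'n"
    and X :: "(real ^ 'n) set"
    and f :: "'m::finite \<Rightarrow> real \<times> (real ^ 'n) \<Rightarrow> real ^ 'n"
    and l :: "'m \<Rightarrow> real \<times> (real ^ 'n) \<Rightarrow> real"
  assumes "T > 0"
    and "compact X"
    and "\<And>j. continuous_on ({0..T} \<times> X) (f j)"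
    and "\<And>j. continuous_on ({0..T} \<times> X) (l j)"
    and "\<And>j. \<exists>L. \<forall>t\<in>{0..T}. L-lipschitz_on X (\<lambda>x. f j (t, x))"
    and "\<And>j. \<exists>L. \<forall>t\<in>{0..T}. L-lipschitz_on X (\<lambda>x. l j (t, x))"
  shows "value_modes T X x0 xT f l = value_W T X x0 xT f l"
  using assms(2-4) by (rule value_modes_eq_value_W)

end
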